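(* For positive reals $a,b>0$ define the means \[ H=\frac{2ab}{a+b},\quad G=\sqrt{ab},\quad A=\frac{a+b}{2},\quad S=\sqrt{\frac{a^2+b^2}{2}}, \] \[ N_1=\Big(\frac{\sqrt a+\sqrt b}{2}\Big)^2,\quad N_2=\Big(\frac{\sqrt a+\sqrt b}{2}\Big)\sqrt{\frac{a+b}{2}},\quad N_3=\frac{a+\sqrt{ab}+b}{3}, \] \[ P_1=\frac{ab(a^2+b^2)}{a^3+b^3},\quad P_2=\frac{ab(a+b)}{a^2+b^2},\quad P_3=\frac{ab(\sqrt a+\sqrt b)}{a^{3/2}+b^{3/2}},\quad P_4=\frac{4ab}{(\sqrt a+\sqrt b)^2}, \] \[ P_5=\Big(\frac{a+b}{\sqrt a+\sqrt b}\Big)^2,\quad P_6=\frac{a^2+b^2}{a+b}, \] all evaluated at $(a,b)$, and for two such means $X,Y$ let $D_{XY}(a,b)=X(a,b)-Y(a,b)$. Then for all $a,b>0$ the following inequalities hold (all $D$'s evaluated at $(a,b)$). (1) $\tfrac18 D_{P_6P_1}\le \tfrac16 D_{P_6P_2}\le D_{SA}\le \tfrac13 D_{SH}\le \tfrac12 D_{AH}$; $\tfrac12 D_{AH}\le \tfrac49 D_{P_6N_2}\le \tfrac13 D_{P_6G}$; $\tfrac12 D_{AH}\le \tfrac37 D_{P_6N_3}$ and $\tfrac12 D_{AH}\le \tfrac25 D_{SP_4}$; each of $\tfrac37 D_{P_6N_3}$ and $\tfrac25 D_{SP_4}$ is $\le \tfrac25 D_{P_6N_1}$ and $\le \tfrac27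 D_{P_6P_4}$; $\tfrac25 D_{P_6N_1}\le \tfrac13 D_{P_6G}$ and $\tfrac27 D_{P_6P_4}\le\tfrac13 D_{P_6G}$; $\tfrac13 D_{P_6G}\le \tfrac25 D_{P_5H}\le 4D_{N_2N_1}$ and $\tfrac13 D_{P_6G}\le \tfrac23 D_{AP_4}\le 4D_{N_2N_1}$; $4D_{N_2N_1}\le \tfrac43 D_{N_2G}\le D_{AG}\le 4D_{AN_2}\le \tfrac23 D_{P_5G}\le D_{P_5N_1}\le \tfrac65 D_{P_5N_3}\le \tfrac43 D_{P_5N_2}\le 2D_{P_5A}$. (2) $D_{SA}\le \tfrac45 D_{SN_2}\le \tfrac23 D_{SN_1}$ and $D_{SA}\le \tfrac34 D_{SN_3}\le \tfrac23 D_{SN_1}$; $\tfrac23 D_{SN_1}\le \tfrac13 D_{P_6G}\le \tfrac25 D_{P_5H}$ and $\tfrac23 D_{SN_1}\le \tfrac12 D_{SG}\le \tfrac25 D_{P_5H}$. (3) each of $\tfrac18 D_{P_6P_1}$ and $\tfrac{2}{13}D_{P_5P_1}$ is $\le \tfrac16 D_{P_6P_2}$ and $\le \tfrac29 D_{P_5P_2}$; $\tfrac16 D_{P_6P_2}\le \tfrac27 D_{P_5P_3}$ and $\tfrac29 D_{P_5P_2}\le \tfrac27 D_{P_5P_3}$; $\tfrac27 D_{P_5P_3}\le \tfrac49 D_{P_6N_2}\le D_{P_6S}\le D_{AG}$.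
   Context: $H,G,A,S$ are the harmonic, geometric, arithmetic and root-mean-square means; $N_3$ is Heron's mean; $P_1,P_2,P_3,P_6$ are the Lehmer means $K_r(a,b)=\frac{a^r+b^r}{a^{r-1}+b^{r-1}}$ for $r=-2,-1,-1/2,2$; $P_4$ is the power mean of order $-1/2$; $N_1$ is the power mean of order $1/2$; $P_5$ is the Gini mean $E_{1/2,1}(a,b)=\big(\frac{a^{1/2}+b^{1/2}}{a+b}\big)^{-2}$. For means $X,Y$, $D_{XY}=X-Y$ (e.g. $D_{SA}=S-A$, $D_{P_6P_1}=P_6-P_1$). *)

theory Defs
  imports Complex_Main
begin

definition mH :: "real \<Rightarrow> real \<Rightarrow> real" where "mH a b = 2*a*b / (a+b)"
definition mG :: "real \<Rightarrow> real \<Rightarrow> real" where "mG a b = sqrt (a*b)"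
definition mA :: "real \<Rightarrow> real \<Rightarrow> real" where "mA a b = (a+b)/2"
definition mS :: "real \<Rightarrow> real \<Rightarrow> real" where "mS a b = sqrt ((a^2+b^2)/2)"
definition mN1 :: "real \<Rightarrow> real \<Rightarrow> real" where "mN1 a b = ((sqrt a + sqrt b)/2)^2"
definition mN2 :: "real \<Rightarrow> real \<Rightarrow> real" where
  "mN2 a b = ((sqrt a + sqrt b)/2) * sqrt ((a+b)/2)"
definition mN3 :: "real \<Rightarrow> real \<Rightarrow> real" where "mN3 a b = (a + sqrt (a*b) + b)/3"
definition mP1 :: "real \<Rightarrow> real \<Rightarrow> real" where "mP1 a b = a*b*(a^2+b^2) / (a^3+b^3)"
definition mP2 :: "real \<Rightarrow> real \<Rightarrow> real" where "mP2 a b = a*b*(a+b) / (a^2+b^2)"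
definition mP3 :: "real \<Rightarrow> real \<Rightarrow> real" where
  "mP3 a b = a*b*(sqrt a + sqrt b) / (a powr (3/2) + b powr (3/2))"
definition mP4 :: "real \<Rightarrow> real \<Rightarrow> real" where "mP4 a b = 4*a*b / (sqrt a + sqrt b)^2"
definition mP5 :: "real \<Rightarrow> real \<Rightarrow> real" where "mP5 a b = ((a+b)/(sqrt a + sqrt b))^2"
definition mP6 :: "real \<Rightarrow> real \<Rightarrow> real" where "mP6 a b = (a^2+b^2)/(a+b)"

definition D :: "(real \<Rightarrow> real \<Rightarrow> real) \<Rightarrow> (real \<Rightarrow> real \<Rightarrow> real) \<Rightarrow> real \<Rightarrow> real \<Rightarrow> real" where
  "D X Y a b = X a b - Y a b"

end

theory Submission
  imports Defs
begin

text \<open>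
  In the coordinates \<open>d = (\<surd>a - \<surd>b)\<^sup>2 \<ge> 0\<close> and \<open>g = \<surd>(ab) > 0\<close> every mean is a rational
  function, except for \<open>S\<close> and \<open>N2\<close>, which are square roots of quadratic forms. After squaring
  away the roots, each inequality says that a certain rational function is nonnegative, and its
  numerator turns out to be \<open>d\<^sup>2\<close> times a polynomial in \<open>d\<close> and \<open>g\<close> all of whose
  coefficients are nonnegative.
\<close>

section \<open>Quotient certificates for inequalities\<close>

text \<open>A certificate format: \<open>n\<close> and \<open>e\<close> are supplied explicitly, so
  their signs are easy to see and what remains is a rational identity, polynomial once denominators
  are cleared.\<close>

lemma le_if_diff_quotient:
  fixes x y n e :: real
  assumes "0 \<le> n" "0 < e" "y - x = n / e"
  shows "x \<le> y"
  using assms by (metis diff_ge_0_iff_ge divide_nonneg_pos)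

lemma sqrt_le_if_diff_quotient:
  fixes x y n e :: real
  assumes "0 \<le> y" "0 \<le> n" "0 < e" "y^2 - x = n / e"
  shows "sqrt x \<le> y"
  using assms by (metis le_if_diff_quotient real_le_lsqrt)

lemma le_sqrt_if_diff_quotient:
  fixes x y n e :: real
  assumes "0 \<le> n" "0 < e" "x - y^2 = n / e"
  shows "y \<le> sqrt x"
  using assms by (metis le_if_diff_quotient real_le_rsqrt)

section \<open>The means in coordinates\<close>

text \<open>
  The auxiliary parameters are \<open>p = a + b\<close>, \<open>q = (\<surd>a + \<surd>b)\<^sup>2\<close>, \<open>h = a - \<surd>(ab) + b\<close>,
  \<open>r = a\<^sup>2 + b\<^sup>2\<close> and \<open>c = a\<^sup>2 - ab + b\<^sup>2\<close>. Keeping them as atoms lets fractions be cleared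
  before anything is expanded in \<open>d\<close> and \<open>g\<close>.
\<close>

locale mean_coordinates =
  fixes d g p q h r c :: real
  assumes d_nonneg: "0 \<le> d" and g_pos: "0 < g"
    and eqs: "p = d + 2*g" "q = d + 4*g" "h = d + g"
      "r = d^2 + 4*d*g + 2*g^2" "c = d^2 + 4*d*g + g^2"
begin

definition "H = 2*g^2 / p"
definition "A = p / 2"
definition "S = sqrt (r / 2)"
definition "N1 = q / 4"
definition "N2 = sqrt (p*q / 8)"
definition "N3 = (p + g) / 3"
definition "P1 = g^2*r / (p*c)"
definition "P2 = g^2*p / r"
definition "P3 = g^2 / h"
definition "P4 = 4*g^2 / q"
definition "P5 = p^2 / q"
definition "P6 = r / p"

lemma pos: "0 < p" "0 < q" "0 < h" "0 < r" "0 < c"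
  using d_nonneg g_pos by (auto simp: eqs intro!: add_nonneg_pos)

lemmas nz = pos[THEN less_imp_neq, symmetric]

lemmas mean_defs =
  H_def A_def S_def N1_def N2_def N3_def P1_def P2_def P3_def P4_def P5_def P6_def

text \<open>Linear dependences among the means: through them several inequalities become
  restatements or linear consequences of others and need no certificate of their own.\<close>

lemma mean_relations:
  "N1 = A/2 + g/2" "N3 = (2/3)*A + g/3" "P6 = 2*A - H" "P5 = 2*A - 2*g + P4"
  by (simp_all add: mean_defs divide_simps nz, unfold eqs, algebra+)

section \<open>The long chain from \<open>P6 - P1\<close> to \<open>P5 - A\<close>\<close>

text \<open>The coefficients are normalizations: for fixed \<open>g\<close>, every weighted
  difference in these chains expands as \<open>d/2\<close> plus higher powers of \<open>d\<close>.
  The linear terms cancel, whence the factor \<open>d^2\<close> in \<open>n\<close>.\<close>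

lemma P6_P1_le_P6_P2: "(1/8) * (P6 - P1) \<le> (1/6) * (P6 - P2)"
  unfolding mean_defs
  by (rule le_if_diff_quotient[where
      n = "d^2*(d^4 + 12*d^3*g + 52*d^2*g^2 + 96*d*g^3 + 64*g^4)" and
      e = "24*p*c*r"])
    (use d_nonneg g_pos pos in simp, use pos in simp,
     simp add: divide_simps nz, unfold eqs, algebra)

lemma P6_P2_le_S_A: "(1/6) * (P6 - P2) \<le> S - A"
proof -
  \<comment> \<open>Solving the claim for its only root gives a rational bound; \<open>?q\<close> is
    that bound over a common denominator. Each later \<open>?q\<close> arises this way.\<close>
  let ?q = "(4*d^4 + 32*d^3*g + 85*d^2*g^2 + 84*d*g^3 + 24*g^4) / (6*p*r)"
  have "?q \<le> S"
    unfolding mean_defs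
    by (rule le_sqrt_if_diff_quotient[where
      n = "d^2*(2*d^6 + 32*d^5*g + 204*d^4*g^2 + 656*d^3*g^3 + 1103*d^2*g^4 + 888*d*g^5 + 240*g^6)" and
      e = "36*p^2*r^2"])
      (use d_nonneg g_pos pos in simp, use pos in simp,
       simp add: field_split_simps nz, unfold eqs, algebra)
  moreover have "?q = (1/6)*P6 + A - (1/6)*P2"
    by (simp add: mean_defs divide_simps nz, unfold eqs, algebra)
  ultimately show ?thesis by argo
qed

text \<open>Since \<open>S^2 = A*P6\<close>, this is AM-GM for \<open>A\<close> and
  \<open>P6\<close>: \<open>?q\<close> equals \<open>(A + P6)/2\<close>.\<close>

lemma S_A_le_S_H: "S - A \<le> (1/3) * (S - H)"
proof -
  let ?q = "(3*d^2 + 12*d*g + 8*g^2) / (4*p)"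
  have "S \<le> ?q"
    unfolding mean_defs
    by (rule sqrt_le_if_diff_quotient[where
      n = "d^2*(d^2 + 8*d*g + 16*g^2)" and
      e = "16*p^2"])
      (use d_nonneg g_pos pos in simp, use d_nonneg g_pos pos in simp, use pos in simp,
       simp add: field_split_simps nz, unfold eqs, algebra)
  moreover have "?q = (3/2)*A - (1/2)*H"
    by (simp add: mean_defs divide_simps nz, unfold eqs, algebra)
  ultimately show ?thesis by argo
qed

text \<open>Solved for \<open>S\<close>, both this and \<open>S_A_le_S_H\<close> read
  \<open>S \<le> (3*A - H)/2\<close>.\<close>

lemma S_H_le_A_H: "(1/3) * (S - H) \<le> (1/2) * (A - H)"
  using S_A_le_S_H mean_relations by argo

lemma A_H_le_P6_N2: "(1/2) * (A - H) \<le> (4/9) * (P6 - N2)"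
proof -
  let ?q = "(7*d^2 + 28*d*g + 32*g^2) / (16*p)"
  have "N2 \<le> ?q"
    unfolding mean_defs
    by (rule sqrt_le_if_diff_quotient[where
      n = "d^2*(17*d^2 + 72*d*g + 80*g^2)" and
      e = "256*p^2"])
      (use d_nonneg g_pos pos in simp, use d_nonneg g_pos pos in simp, use pos in simp,
       simp add: field_split_simps nz, unfold eqs, algebra)
  moreover have "?q = P6 - (9/8)*A + (9/8)*H"
    by (simp add: mean_defs divide_simps nz, unfold eqs, algebra)
  ultimately show ?thesis by argo
qed

lemma P6_N2_le_P6_G: "(4/9) * (P6 - N2) \<le> (1/3) * (P6 - g)"
proof -
  let ?q = "(d^2 + 7*d*g + 8*g^2) / (4*p)"
  have "?q \<le> N2"
    unfolding mean_defs
    by (rule le_sqrt_if_diff_quotient[where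
      n = "d^2*(d^2 + 6*d*g + 7*g^2)" and
      e = "16*p^2"])
      (use d_nonneg g_pos pos in simp, use pos in simp,
       simp add: field_split_simps nz, unfold eqs, algebra)
  moreover have "?q = (1/4)*P6 + (3/4)*g"
    by (simp add: mean_defs divide_simps nz, unfold eqs, algebra)
  ultimately show ?thesis by argo
qed

lemma A_H_le_P6_N3: "(1/2) * (A - H) \<le> (3/7) * (P6 - N3)"
  unfolding mean_defs
  by (rule le_if_diff_quotient[where
      n = "d^2" and
      e = "28*p"])
    (use d_nonneg g_pos pos in simp, use pos in simp,
     simp add: divide_simps nz, unfold eqs, algebra)

text \<open>The two sides agree even to second order in \<open>d\<close>, so \<open>n\<close> has
  the factor \<open>d^3\<close>.\<close>

lemma A_H_le_S_P4: "(1/2) * (A - H) \<le> (2/5) * (S - P4)"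
proof -
  let ?q = "(5*d^3 + 40*d^2*g + 112*d*g^2 + 64*g^3) / (8*p*q)"
  have "?q \<le> S"
    unfolding mean_defs
    by (rule le_sqrt_if_diff_quotient[where
      n = "d^3*(7*d^3 + 112*d^2*g + 544*d*g^2 + 896*g^3)" and
      e = "64*p^2*q^2"])
      (use d_nonneg g_pos pos in simp, use pos in simp,
       simp add: field_split_simps nz, unfold eqs, algebra)
  moreover have "?q = (5/4)*A + P4 - (5/4)*H"
    by (simp add: mean_defs divide_simps nz, unfold eqs, algebra)
  ultimately show ?thesis by argo
qed

lemma P6_N3_le_P6_N1: "(3/7) * (P6 - N3) \<le> (2/5) * (P6 - N1)"
  unfolding mean_defs
  by (rule le_if_diff_quotient[where
      n = "d^2" and
      e = "70*p"])
    (use d_nonneg g_pos pos in simp, use pos in simp,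
     simp add: divide_simps nz, unfold eqs, algebra)

lemma P6_N3_le_P6_P4: "(3/7) * (P6 - N3) \<le> (2/7) * (P6 - P4)"
  unfolding mean_defs
  by (rule le_if_diff_quotient[where
      n = "d^2*g" and
      e = "7*p*q"])
    (use d_nonneg g_pos pos in simp, use pos in simp,
     simp add: divide_simps nz, unfold eqs, algebra)

lemma S_P4_le_P6_N1: "(2/5) * (S - P4) \<le> (2/5) * (P6 - N1)"
proof -
  let ?q = "(3*d^3 + 22*d^2*g + 56*d*g^2 + 32*g^3) / (4*p*q)"
  have "S \<le> ?q"
    unfolding mean_defs
    by (rule sqrt_le_if_diff_quotient[where
      n = "d^2*(d^4 + 4*d^3*g + 4*d^2*g^2 + 32*d*g^3 + 128*g^4)" and
      e = "16*p^2*q^2"])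
      (use d_nonneg g_pos pos in simp, use d_nonneg g_pos pos in simp, use pos in simp,
       simp add: field_split_simps nz, unfold eqs, algebra)
  moreover have "?q = P6 - N1 + P4"
    by (simp add: mean_defs divide_simps nz, unfold eqs, algebra)
  ultimately show ?thesis by argo
qed

lemma S_P4_le_P6_P4: "(2/5) * (S - P4) \<le> (2/7) * (P6 - P4)"
proof -
  let ?q = "(5*d^3 + 40*d^2*g + 98*d*g^2 + 56*g^3) / (7*p*q)"
  have "S \<le> ?q"
    unfolding mean_defs
    by (rule sqrt_le_if_diff_quotient[where
      n = "d^2*(d^4 + 16*d^3*g + 162*d^2*g^2 + 728*d*g^3 + 1120*g^4)" and
      e = "98*p^2*q^2"])
      (use d_nonneg g_pos pos in simp, use d_nonneg g_pos pos in simp, use pos in simp,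
       simp add: field_split_simps nz, unfold eqs, algebra)
  moreover have "?q = (5/7)*P6 + (2/7)*P4"
    by (simp add: mean_defs divide_simps nz, unfold eqs, algebra)
  ultimately show ?thesis by argo
qed

lemma P6_N1_le_P6_G: "(2/5) * (P6 - N1) \<le> (1/3) * (P6 - g)"
  unfolding mean_defs
  by (rule le_if_diff_quotient[where
      n = "d^2" and
      e = "30*p"])
    (use d_nonneg g_pos pos in simp, use pos in simp,
     simp add: divide_simps nz, unfold eqs, algebra)

lemma P6_P4_le_P6_G: "(2/7) * (P6 - P4) \<le> (1/3) * (P6 - g)"
  unfolding mean_defs
  by (rule le_if_diff_quotient[where
      n = "d^2*(d + g)" and
      e = "21*p*q"])
    (use d_nonneg g_pos pos in simp, use pos in simp,
     simp add: divide_simps nz, unfold eqs, algebra)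

lemma P6_G_le_P5_H: "(1/3) * (P6 - g) \<le> (2/5) * (P5 - H)"
  unfolding mean_defs
  by (rule le_if_diff_quotient[where
      n = "d^2*(d + g)" and
      e = "15*p*q"])
    (use d_nonneg g_pos pos in simp, use pos in simp,
     simp add: divide_simps nz, unfold eqs, algebra)

lemma P5_H_le_N2_N1: "(2/5) * (P5 - H) \<le> 4 * (N2 - N1)"
proof -
  let ?q = "(7*d^3 + 62*d^2*g + 180*d*g^2 + 160*g^3) / (20*p*q)"
  have "?q \<le> N2"
    unfolding mean_defs
    by (rule le_sqrt_if_diff_quotient[where
      n = "d^2*(d^4 + 32*d^3*g + 236*d^2*g^2 + 640*d*g^3 + 560*g^4)" and
      e = "400*p^2*q^2"])
      (use d_nonneg g_pos pos in simp, use pos in simp,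
       simp add: field_split_simps nz, unfold eqs, algebra)
  moreover have "?q = (1/10)*P5 + N1 - (1/10)*H"
    by (simp add: mean_defs divide_simps nz, unfold eqs, algebra)
  ultimately show ?thesis by argo
qed

lemma P6_G_le_A_P4: "(1/3) * (P6 - g) \<le> (2/3) * (A - P4)"
  unfolding mean_defs
  by (rule le_if_diff_quotient[where
      n = "d^2*g" and
      e = "3*p*q"])
    (use d_nonneg g_pos pos in simp, use pos in simp,
     simp add: divide_simps nz, unfold eqs, algebra)

lemma A_P4_le_N2_N1: "(2/3) * (A - P4) \<le> 4 * (N2 - N1)"
proof -
  let ?q = "(2*d^2 + 15*d*g + 24*g^2) / (6*q)"
  have "?q \<le> N2"
    unfolding mean_defs
    by (rule le_sqrt_if_diff_quotient[where
      n = "d^2*(d^2 + 6*d*g + 6*g^2)" and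
      e = "72*q^2"])
      (use d_nonneg g_pos pos in simp, use pos in simp,
       simp add: field_split_simps nz, unfold eqs, algebra)
  moreover have "?q = (1/6)*A + N1 - (1/6)*P4"
    by (simp add: mean_defs divide_simps nz, unfold eqs, algebra)
  ultimately show ?thesis by argo
qed

text \<open>Since \<open>N2^2 = A*N1\<close>, this is AM-GM for \<open>A\<close> and
  \<open>N1\<close>: \<open>?q\<close> equals \<open>(A + N1)/2 = (3*A + g)/4\<close>.\<close>

lemma N2_N1_le_N2_G: "4 * (N2 - N1) \<le> (4/3) * (N2 - g)"
proof -
  let ?q = "(3*d + 8*g) / (8)"
  have "N2 \<le> ?q"
    unfolding mean_defs
    by (rule sqrt_le_if_diff_quotient[where
      n = "d^2" and
      e = "64"])
      (use d_nonneg g_pos pos in simp, use d_nonneg g_pos pos in simp, use pos in simp,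
       simp add: field_split_simps nz, unfold eqs, algebra)
  moreover have "?q = (3/2)*N1 - (1/2)*g"
    by (simp add: mean_defs divide_simps nz, unfold eqs, algebra)
  ultimately show ?thesis by argo
qed

text \<open>Because \<open>N1 = (A + g)/2\<close>, the preceding inequality, this one and the next
  all amount to \<open>N2 \<le> (3*A + g)/4\<close>.\<close>

lemma N2_G_le_A_G: "(4/3) * (N2 - g) \<le> A - g"
  using N2_N1_le_N2_G mean_relations by argo

lemma A_G_le_A_N2: "A - g \<le> 4 * (A - N2)"
  using N2_N1_le_N2_G mean_relations by argo

text \<open>Eliminating \<open>P5\<close> and \<open>N1\<close> turns this and
  \<open>A_P4_le_N2_N1\<close> into the same lower bound for \<open>N2\<close> in terms of
  \<open>A\<close>, \<open>g\<close> and \<open>P4\<close>.\<close>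

lemma A_N2_le_P5_G: "4 * (A - N2) \<le> (2/3) * (P5 - g)"
  using A_P4_le_N2_N1 mean_relations by argo

lemma P5_G_le_P5_N1: "(2/3) * (P5 - g) \<le> P5 - N1"
  unfolding mean_defs
  by (rule le_if_diff_quotient[where
      n = "d^2" and
      e = "12*q"])
    (use d_nonneg g_pos pos in simp, use pos in simp,
     simp add: divide_simps nz, unfold eqs, algebra)

lemma P5_N1_le_P5_N3: "P5 - N1 \<le> (6/5) * (P5 - N3)"
  unfolding mean_defs
  by (rule le_if_diff_quotient[where
      n = "d^2" and
      e = "20*q"])
    (use d_nonneg g_pos pos in simp, use pos in simp,
     simp add: divide_simps nz, unfold eqs, algebra)

lemma P5_N3_le_P5_N2: "(6/5) * (P5 - N3) \<le> (4/3) * (P5 - N2)"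
proof -
  let ?q = "(4*d^2 + 25*d*g + 40*g^2) / (10*q)"
  have "N2 \<le> ?q"
    unfolding mean_defs
    by (rule sqrt_le_if_diff_quotient[where
      n = "d^2*(7*d^2 + 50*d*g + 90*g^2)" and
      e = "200*q^2"])
      (use d_nonneg g_pos pos in simp, use d_nonneg g_pos pos in simp, use pos in simp,
       simp add: field_split_simps nz, unfold eqs, algebra)
  moreover have "?q = (1/10)*P5 + (9/10)*N3"
    by (simp add: mean_defs divide_simps nz, unfold eqs, algebra)
  ultimately show ?thesis by argo
qed

lemma P5_N2_le_P5_A: "(4/3) * (P5 - N2) \<le> 2 * (P5 - A)"
proof -
  let ?q = "(d^2 + 10*d*g + 16*g^2) / (4*q)"
  have "?q \<le> N2"
    unfolding mean_defs
    by (rule le_sqrt_if_diff_quotient[where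
      n = "d^2*(d^2 + 8*d*g + 12*g^2)" and
      e = "16*q^2"])
      (use d_nonneg g_pos pos in simp, use pos in simp,
       simp add: field_split_simps nz, unfold eqs, algebra)
  moreover have "?q = - (1/2)*P5 + (3/2)*A"
    by (simp add: mean_defs divide_simps nz, unfold eqs, algebra)
  ultimately show ?thesis by argo
qed

section \<open>Differences between \<open>S\<close> and smaller means\<close>

text \<open>Equivalent to \<open>S + g \<le> 2*A\<close>, which follows from
  \<open>S^2 + g^2 = 2*A^2\<close> because an arithmetic mean is at most the quadratic mean.\<close>

lemma S_A_le_S_N3: "S - A \<le> (3/4) * (S - N3)"
proof -
  let ?q = "d + g"
  have "S \<le> ?q"
    unfolding mean_defs
    by (rule sqrt_le_if_diff_quotient[where
      n = "d^2" and
      e = "2"])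
      (use d_nonneg g_pos pos in simp, use d_nonneg g_pos pos in simp, use pos in simp,
       simp add: field_split_simps nz, unfold eqs, algebra)
  moreover have "?q = 4*A - 3*N3"
    by (simp add: mean_defs divide_simps nz, unfold eqs, algebra)
  ultimately show ?thesis by argo
qed

text \<open>Like \<open>S_N1_le_S_G\<close>, again the bound \<open>S \<le> 2*A - g\<close>.\<close>

lemma S_N3_le_S_N1: "(3/4) * (S - N3) \<le> (2/3) * (S - N1)"
  using S_A_le_S_N3 mean_relations by argo

text \<open>After eliminating \<open>N1\<close> and \<open>P6\<close>, \<open>g\<close> cancels and
  \<open>S \<le> (3*A - H)/2\<close> remains.\<close>

lemma S_N1_le_P6_G: "(2/3) * (S - N1) \<le> (1/3) * (P6 - g)"
  using S_A_le_S_H mean_relations by argo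

lemma S_N1_le_S_G: "(2/3) * (S - N1) \<le> (1/2) * (S - g)"
  using S_A_le_S_N3 mean_relations by argo

lemma S_G_le_P5_H: "(1/2) * (S - g) \<le> (2/5) * (P5 - H)"
proof -
  let ?q = "(4*d^3 + 29*d^2*g + 70*d*g^2 + 40*g^3) / (5*p*q)"
  have "S \<le> ?q"
    unfolding mean_defs
    by (rule sqrt_le_if_diff_quotient[where
      n = "d^2*(7*d^4 + 64*d^3*g + 252*d^2*g^2 + 560*d*g^3 + 640*g^4)" and
      e = "50*p^2*q^2"])
      (use d_nonneg g_pos pos in simp, use d_nonneg g_pos pos in simp, use pos in simp,
       simp add: field_split_simps nz, unfold eqs, algebra)
  moreover have "?q = (4/5)*P5 + g - (4/5)*H"
    by (simp add: mean_defs divide_simps nz, unfold eqs, algebra)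
  ultimately show ?thesis by argo
qed

section \<open>The chain through \<open>P5 - P3\<close>\<close>

lemma P6_P1_le_P5_P2: "(1/8) * (P6 - P1) \<le> (2/9) * (P5 - P2)"
  unfolding mean_defs
  by (rule le_if_diff_quotient[where
      n = "d^2*(7*d^5 + 80*d^4*g + 348*d^3*g^2 + 752*d^2*g^3 + 940*d*g^4 + 672*g^5)" and
      e = "72*p*q*c*r"])
    (use d_nonneg g_pos pos in simp, use pos in simp,
     simp add: divide_simps nz, unfold eqs, algebra)

lemma P5_P1_le_P6_P2: "(2/13) * (P5 - P1) \<le> (1/6) * (P6 - P2)"
  unfolding mean_defs
  by (rule le_if_diff_quotient[where
      n = "d^2*(d^5 + 40*d^4*g + 364*d^3*g^2 + 1336*d^2*g^3 + 2095*d*g^4 + 1096*g^5)" and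
      e = "78*p*q*c*r"])
    (use d_nonneg g_pos pos in simp, use pos in simp,
     simp add: divide_simps nz, unfold eqs, algebra)

lemma P5_P1_le_P5_P2: "(2/13) * (P5 - P1) \<le> (2/9) * (P5 - P2)"
  unfolding mean_defs
  by (rule le_if_diff_quotient[where
      n = "2*d^2*(4*d^5 + 56*d^4*g + 312*d^3*g^2 + 872*d^2*g^3 + 1243*d*g^4 + 744*g^5)" and
      e = "117*p*q*c*r"])
    (use d_nonneg g_pos pos in simp, use pos in simp,
     simp add: divide_simps nz, unfold eqs, algebra)

lemma P6_P2_le_P5_P3: "(1/6) * (P6 - P2) \<le> (2/7) * (P5 - P3)"
  unfolding mean_defs
  by (rule le_if_diff_quotient[where
      n = "d^2*(5*d^4 + 41*d^3*g + 123*d^2*g^2 + 179*d*g^3 + 128*g^4)" and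
      e = "42*p*q*r*h"])
    (use d_nonneg g_pos pos in simp, use pos in simp,
     simp add: divide_simps nz, unfold eqs, algebra)

lemma P5_P2_le_P5_P3: "(2/9) * (P5 - P2) \<le> (2/7) * (P5 - P3)"
  unfolding mean_defs
  by (rule le_if_diff_quotient[where
      n = "2*d^2*(2*d^3 + 18*d^2*g + 58*d*g^2 + 69*g^3)" and
      e = "63*q*r*h"])
    (use d_nonneg g_pos pos in simp, use pos in simp,
     simp add: divide_simps nz, unfold eqs, algebra)

lemma P5_P3_le_P6_N2: "(2/7) * (P5 - P3) \<le> (4/9) * (P6 - N2)"
proof -
  let ?q = "(5*d^4 + 63*d^3*g + 211*d^2*g^2 + 238*d*g^3 + 112*g^4) / (14*p*q*h)"
  have "N2 \<le> ?q"
    unfolding mean_defs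
    by (rule sqrt_le_if_diff_quotient[where
      n = "d^2*(d^6 + 280*d^5*g + 3877*d^4*g^2 + 19418*d^3*g^3 + 43654*d^2*g^4 + 44464*d*g^5 +
      18088*g^6)" and
      e = "392*p^2*q^2*h^2"])
      (use d_nonneg g_pos pos in simp, use d_nonneg g_pos pos in simp, use pos in simp,
       simp add: field_split_simps nz, unfold eqs, algebra)
  moreover have "?q = P6 - (9/14)*P5 + (9/14)*P3"
    by (simp add: mean_defs divide_simps nz, unfold eqs, algebra)
  ultimately show ?thesis by argo
qed

text \<open>Agreement to second order in \<open>d\<close> again gives a factor
  \<open>d^3\<close>.\<close>

lemma P6_S_le_A_G: "P6 - S \<le> A - g"
proof -
  let ?q = "(d^2 + 6*d*g + 4*g^2) / (2*p)"
  have "?q \<le> S"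
    unfolding mean_defs
    by (rule le_sqrt_if_diff_quotient[where
      n = "d^3*(d + 4*g)" and
      e = "4*p^2"])
      (use d_nonneg g_pos pos in simp, use pos in simp,
       simp add: field_split_simps nz, unfold eqs, algebra)
  moreover have "?q = P6 - A + g"
    by (simp add: mean_defs divide_simps nz, unfold eqs, algebra)
  ultimately show ?thesis by argo
qed

section \<open>Comparisons involving both roots\<close>

text \<open>The bounds \<open>4*N2 \<le> 3*A + g\<close> and \<open>S \<le> 2*A - g\<close> add up
  to \<open>S + 4*N2 \<le> 5*A\<close>.\<close>

lemma S_A_le_S_N2: "S - A \<le> (4/5) * (S - N2)"
  using A_G_le_A_N2 S_A_le_S_N3 mean_relations by argo

lemma S_N2_le_S_N1: "(4/5) * (S - N2) \<le> (2/3) * (S - N1)"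
proof -
  \<comment> \<open>Squaring \<open>S + 5 N1 \<le> 6 N2\<close> eliminates \<open>N2\<close> and leaves an upper bound for \<open>S\<close>.\<close>
  have "S \<le> (39*d^2 + 200*d*g + 160*g^2) / (40*q)"
    unfolding mean_defs
    by (rule sqrt_le_if_diff_quotient[where
      n = "d^2*(721*d^2 + 6000*d*g + 12480*g^2)" and
      e = "1600*q^2"])
      (use d_nonneg g_pos pos in simp, use d_nonneg g_pos pos in simp, use pos in simp,
       simp add: field_split_simps nz, unfold eqs, algebra)
  then have "40*q*S \<le> 39*d^2 + 200*d*g + 160*g^2"
    using pos by (simp add: mean_defs field_simps)
  \<comment> \<open>Both squares are written with the same terms \<open>r/2 + 25*q^2/16\<close>;
    comparing the rest is exactly the bound on \<open>S\<close>.\<close>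
  moreover have "(S + 5*N1)^2 = r/2 + 25*q^2/16 + 40*q*S/16"
    using pos by (simp add: mean_defs power2_sum power_divide)
  moreover have "(6*N2)^2 = r/2 + 25*q^2/16 + (39*d^2 + 200*d*g + 160*g^2)/16"
    using pos by (simp add: mean_defs power_mult_distrib, unfold eqs, algebra)
  ultimately have "(S + 5*N1)^2 \<le> (6*N2)^2"
    by argo
  then have "S + 5*N1 \<le> 6*N2"
    by (rule power2_le_imp_le) (use pos in \<open>simp add: mean_defs\<close>)
  then show ?thesis by argo
qed

lemma P6_N2_le_P6_S: "(4/9) * (P6 - N2) \<le> P6 - S"
proof -
  \<comment> \<open>Squaring \<open>9 S \<le> 5 P6 + 4 N2\<close> eliminates \<open>S\<close> and leaves a lower bound for \<open>N2\<close>.\<close>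
  let ?n = "27*d^4 + 208*d^3*g + 638*d^2*g^2 + 920*d*g^3 + 320*g^4"
  have "?n / (80*p*r) \<le> N2"
    unfolding mean_defs
    by (rule le_sqrt_if_diff_quotient[where
      n = "d^2*(71*d^6 + 3168*d^5*g + 31084*d^4*g^2 + 132912*d^3*g^3 + 284156*d^2*g^4 +
      286560*d*g^5 + 89280*g^6)" and
      e = "6400*p^2*r^2"])
      (use d_nonneg g_pos pos in simp, use pos in simp,
       simp add: field_split_simps nz, unfold eqs, algebra)
  then have "40*P6 * (?n / (80*p*r)) \<le> 40*P6 * N2"
    by (rule mult_left_mono) (use pos in \<open>simp add: mean_defs\<close>)
  moreover have "(5*P6 + 4*N2)^2 = 25*P6^2 + 2*p*q + 40*P6 * N2"
    using pos by (simp add: mean_defs power2_sum power_mult_distrib power_divide)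
  \<comment> \<open>An identity by the choice of \<open>?n\<close>: the quotient is
    \<open>(81*S^2 - 25*P6^2 - 16*N2^2) / (40*P6)\<close>.\<close>
  moreover have "(9*S)^2 = 25*P6^2 + 2*p*q + 40*P6 * (?n / (80*p*r))"
    using pos by (simp add: mean_defs power_mult_distrib field_split_simps, unfold eqs, algebra)
  ultimately have "(9*S)^2 \<le> (5*P6 + 4*N2)^2"
    by argo
  then have "9*S \<le> 5*P6 + 4*N2"
    by (rule power2_le_imp_le) (use pos in \<open>simp add: mean_defs\<close>)
  then show ?thesis by argo
qed

end

section \<open>Transfer to the original means\<close>

theorem theorem3p1:
  fixes a b :: real
  assumes "a > 0" and "b > 0"
  shows
  \<comment> \<open>(1)\<close>
    "(1/8) * D mP6 mP1 a b \<le> (1/6) * D mP6 mP2 a b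
   \<and> (1/6) * D mP6 mP2 a b \<le> D mS mA a b
   \<and> D mS mA a b \<le> (1/3) * D mS mH a b
   \<and> (1/3) * D mS mH a b \<le> (1/2) * D mA mH a b
   \<and> (1/2) * D mA mH a b \<le> (4/9) * D mP6 mN2 a b
   \<and> (4/9) * D mP6 mN2 a b \<le> (1/3) * D mP6 mG a b
   \<and> (1/2) * D mA mH a b \<le> (3/7) * D mP6 mN3 a b
   \<and> (1/2) * D mA mH a b \<le> (2/5) * D mS mP4 a b
   \<and> (3/7) * D mP6 mN3 a b \<le> (2/5) * D mP6 mN1 a b
   \<and> (3/7) * D mP6 mN3 a b \<le> (2/7) * D mP6 mP4 a b
   \<and> (2/5) * D mS mP4 a b \<le> (2/5) * D mP6 mN1 a b
   \<and> (2/5) * D mS mP4 a b \<le> (2/7) * D mP6 mP4 a b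
   \<and> (2/5) * D mP6 mN1 a b \<le> (1/3) * D mP6 mG a b
   \<and> (2/7) * D mP6 mP4 a b \<le> (1/3) * D mP6 mG a b
   \<and> (1/3) * D mP6 mG a b \<le> (2/5) * D mP5 mH a b
   \<and> (2/5) * D mP5 mH a b \<le> 4 * D mN2 mN1 a b
   \<and> (1/3) * D mP6 mG a b \<le> (2/3) * D mA mP4 a b
   \<and> (2/3) * D mA mP4 a b \<le> 4 * D mN2 mN1 a b
   \<and> 4 * D mN2 mN1 a b \<le> (4/3) * D mN2 mG a b
   \<and> (4/3) * D mN2 mG a b \<le> D mA mG a b
   \<and> D mA mG a b \<le> 4 * D mA mN2 a b
   \<and> 4 * D mA mN2 a b \<le> (2/3) * D mP5 mG a b
   \<and> (2/3) * D mP5 mG a b \<le> D mP5 mN1 a b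
   \<and> D mP5 mN1 a b \<le> (6/5) * D mP5 mN3 a b
   \<and> (6/5) * D mP5 mN3 a b \<le> (4/3) * D mP5 mN2 a b
   \<and> (4/3) * D mP5 mN2 a b \<le> 2 * D mP5 mA a b
   \<comment> \<open>(2)\<close>
   \<and> D mS mA a b \<le> (4/5) * D mS mN2 a b
   \<and> (4/5) * D mS mN2 a b \<le> (2/3) * D mS mN1 a b
   \<and> D mS mA a b \<le> (3/4) * D mS mN3 a b
   \<and> (3/4) * D mS mN3 a b \<le> (2/3) * D mS mN1 a b
   \<and> (2/3) * D mS mN1 a b \<le> (1/3) * D mP6 mG a b
   \<and> (1/3) * D mP6 mG a b \<le> (2/5) * D mP5 mH a b
   \<and> (2/3) * D mS mN1 a b \<le> (1/2) * D mS mG a b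
   \<and> (1/2) * D mS mG a b \<le> (2/5) * D mP5 mH a b
   \<comment> \<open>(3)\<close>
   \<and> (1/8) * D mP6 mP1 a b \<le> (1/6) * D mP6 mP2 a b
   \<and> (1/8) * D mP6 mP1 a b \<le> (2/9) * D mP5 mP2 a b
   \<and> (2/13) * D mP5 mP1 a b \<le> (1/6) * D mP6 mP2 a b
   \<and> (2/13) * D mP5 mP1 a b \<le> (2/9) * D mP5 mP2 a b
   \<and> (1/6) * D mP6 mP2 a b \<le> (2/7) * D mP5 mP3 a b
   \<and> (2/9) * D mP5 mP2 a b \<le> (2/7) * D mP5 mP3 a b
   \<and> (2/7) * D mP5 mP3 a b \<le> (4/9) * D mP6 mN2 a b
   \<and> (4/9) * D mP6 mN2 a b \<le> D mP6 mS a b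
   \<and> D mP6 mS a b \<le> D mA mG a b"
proof -
  define x y where "x = sqrt a" and "y = sqrt b"
  have x: "0 < x" and y: "0 < y" and a: "a = x^2" and b: "b = y^2"
    using assms by (auto simp: x_def y_def)
  interpret m: mean_coordinates "(x - y)^2" "x*y" "x^2 + y^2" "(x + y)^2" "x^2 - x*y + y^2"
    "x^4 + y^4" "x^4 - x^2*y^2 + y^4"
    by unfold_locales (simp, use x y in simp, algebra+)
  have roots: "sqrt a = x" "sqrt b = y"
    by (simp_all add: x_def y_def)
  \<comment> \<open>Natural powers of \<open>x\<close> and \<open>y\<close> are rewritten as real
    powers, so that the exponents multiply.\<close>
  have powr: "a powr (3/2) = x^3" "b powr (3/2) = y^3"
    using x y powr_powr[of x 2 "3/2"] powr_powr[of y 2 "3/2"]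
    by (simp_all add: a b flip: powr_numeral)
  have H: "mH a b = m.H" and G: "mG a b = x*y" and A: "mA a b = m.A"
    using x y by (simp_all add: mH_def mG_def mA_def m.mean_defs a b real_sqrt_mult power_mult_distrib)
  have S: "mS a b = m.S"
    by (simp add: mS_def m.mean_defs a b flip: power_mult)
  have N1: "mN1 a b = m.N1"
    by (simp add: mN1_def m.mean_defs roots power_divide)
  \<comment> \<open>The positive factor \<open>(x + y)/2\<close> is squared to move it under the
    root.\<close>
  have "m.N2 = sqrt (((x + y)/2)^2 * ((x^2 + y^2)/2))"
    by (simp add: m.mean_defs power_divide mult.commute)
  also have "\<dots> = (x + y)/2 * sqrt ((x^2 + y^2)/2)"
    unfolding real_sqrt_mult using x y by simp
  finally have N2: "mN2 a b = m.N2"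
    by (simp add: mN2_def roots) (simp add: a b)
  have N3: "mN3 a b = m.N3"
    using x y by (simp add: mN3_def m.mean_defs a b real_sqrt_mult)
  have "a^3 + b^3 = (x^2 + y^2) * (x^4 - x^2*y^2 + y^4)"
    unfolding a b by algebra
  then have P1: "mP1 a b = m.P1"
    by (simp add: mP1_def m.mean_defs a b power_mult_distrib flip: power_mult)
  have P2: "mP2 a b = m.P2"
    by (simp add: mP2_def m.mean_defs a b power_mult_distrib flip: power_mult)
  \<comment> \<open>The positive factor \<open>x + y\<close> cancels in \<open>mP3\<close>, leaving
    \<open>g^2 / h\<close>.\<close>
  have "x^3 + y^3 = (x + y) * (x^2 - x*y + y^2)"
    by algebra
  then have P3: "mP3 a b = m.P3"
    using x y by (simp add: mP3_def m.mean_defs roots powr power_mult_distrib) (simp add: a b)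
  have P4: "mP4 a b = m.P4" and P5: "mP5 a b = m.P5"
    by (simp_all add: mP4_def mP5_def m.mean_defs roots power_divide) (simp_all add: a b power_mult_distrib)
  have P6: "mP6 a b = m.P6"
    by (simp add: mP6_def m.mean_defs a b flip: power_mult)
  show ?thesis
    unfolding D_def H G A S N1 N2 N3 P1 P2 P3 P4 P5 P6
    by (intro conjI m.P6_P1_le_P6_P2
      m.P6_P2_le_S_A
      m.S_A_le_S_H
      m.S_H_le_A_H
      m.A_H_le_P6_N2
      m.P6_N2_le_P6_G
      m.A_H_le_P6_N3
      m.A_H_le_S_P4
      m.P6_N3_le_P6_N1
      m.P6_N3_le_P6_P4
      m.S_P4_le_P6_N1
      m.S_P4_le_P6_P4
      m.P6_N1_le_P6_G
      m.P6_P4_le_P6_G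
      m.P6_G_le_P5_H
      m.P5_H_le_N2_N1
      m.P6_G_le_A_P4
      m.A_P4_le_N2_N1
      m.N2_N1_le_N2_G
      m.N2_G_le_A_G
      m.A_G_le_A_N2
      m.A_N2_le_P5_G
      m.P5_G_le_P5_N1
      m.P5_N1_le_P5_N3
      m.P5_N3_le_P5_N2
      m.P5_N2_le_P5_A
      m.S_A_le_S_N2
      m.S_N2_le_S_N1
      m.S_A_le_S_N3
      m.S_N3_le_S_N1
      m.S_N1_le_P6_G
      m.S_N1_le_S_G
      m.S_G_le_P5_H
      m.P6_P1_le_P5_P2
      m.P5_P1_le_P6_P2
      m.P5_P1_le_P5_P2
      m.P6_P2_le_P5_P3
      m.P5_P2_le_P5_P3
      m.P5_P3_le_P6_N2
      m.P6_N2_le_P6_S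
      m.P6_S_le_A_G)
qed

end
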